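(* Let $\epsilon^*>0$, $\beta=\frac{8}{3}+\epsilon^*$, $q=\sqrt{\beta n}$, and let $n$ be sufficiently large. Suppose Breaker plays the $(n,q)$-triangle game according to the strategy described in the context, and that no turn of the game is an isolation turn. Then for every turn $s$ the total potential satisfies $\mathrm{POT}_s<2n$.
   Context: The $(n,q)$-triangle game is played on the complete graph $K_n$ with vertex set $V$, $|V|=n$. In every turn, Maker first claims one previously unclaimed edge and then Breaker claims $q$ previously unclaimed edges. Maker wins if he claims all three edges of a triangle, otherwise Breaker wins. $\deg_M(v)$, $\deg_B(v)$ denote the number of edges at $v$ claimed by Maker, resp. Breaker; a subscript $t$ denotes the value directly after turn $t$ (index $0$: start of the game). Fix $\delta\in(0,1-\frac{8}{3\beta})$. Let $p_0=\frac{8}{\beta(1-\delta)(3+\delta)}$ and $\mu=1+\frac{6\beta\ln n}{\delta q}$. For $v\in V$ let $\deg^*(v)=n-p_0\left(\frac{q^2(1-\delta)(3+\delta)}{8}-\deg_M(v)\left(q-\frac{\deg_M(v)}{2}\right)\right)$, $d(v)=\deg^*(v)-\deg_B(v)$, and $\mathrm{pot}(v)=0$ if $\deg_M(v)+\deg_B(v)=n-1$, $\mathrm{pot}(v)=\mu^{d(v)/q}$ otherwise. For an unclaimed edge $e=\{x,y\}$, $\mathrm{pot}(e)=\mathrm{pot}(x)+\mathrm{pot}(y)$. The total potential after turn $t$ is $\mathrm{POT}_t=\sum_{v\in V}\mathrm{pot}_t(v)$. Breaker's strategy: in turn $t$ let $\{u,v\}$ be Maker's edge. Part 1: Breaker claims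 $\deg_{M,t-1}(v)$ edges incident to $u$ and $\deg_{M,t-1}(u)$ edges incident to $v$, namely the edges closing all newly created Maker paths of length $2$; if such an edge is already claimed he claims an arbitrary unclaimed edge incident to $u$ (resp. $v$) instead; if all edges incident to $u$ (resp. $v$) are already claimed, the turn is called an isolation turn and Breaker claims arbitrary unclaimed edges instead. Part 2: with the remaining edges of the turn, Breaker iteratively claims an unclaimed edge $e$ of maximum current potential $\mathrm{pot}(e)$, until he has claimed $q$ edges in this turn. *)

theory Defs
  imports Complex_Main
begin

definition complete_edges :: "'v set \<Rightarrow> 'v set set" where
  "complete_edges V = {e. e \<subseteq> V \<and> card e = 2}"

definition unclaimed :: "'v set \<Rightarrow> 'v set set \<Rightarrow> 'v set set \<Rightarrow> 'v set set" where
  "unclaimed V M B = complete_edges V - (M \<union> B)"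

definition deg :: "'v set set \<Rightarrow> 'v \<Rightarrow> nat" where
  "deg F v = card {e \<in> F. v \<in> e}"

text \<open>Throughout, \<open>M\<close> and \<open>B\<close> are the edge sets claimed so far by Maker and Breaker,
  and \<open>n\<close> is \<open>card V\<close>.\<close>

definition p0 :: "real \<Rightarrow> real \<Rightarrow> real" where
  "p0 \<beta> \<delta> = 8 / (\<beta> * (1 - \<delta>) * (3 + \<delta>))"

definition mu :: "'v set \<Rightarrow> nat \<Rightarrow> real \<Rightarrow> real \<Rightarrow> real" where
  "mu V q \<beta> \<delta> = 1 + 6 * \<beta> * ln (real (card V)) / (\<delta> * real q)"

definition deg_star :: "'v set \<Rightarrow> nat \<Rightarrow> real \<Rightarrow> real \<Rightarrow> 'v set set \<Rightarrow> 'v \<Rightarrow> real" where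
  "deg_star V q \<beta> \<delta> M v =
     real (card V) - p0 \<beta> \<delta> * ((real q)\<^sup>2 * (1 - \<delta>) * (3 + \<delta>) / 8
       - real (deg M v) * (real q - real (deg M v) / 2))"

definition danger ::
  "'v set \<Rightarrow> nat \<Rightarrow> real \<Rightarrow> real \<Rightarrow> 'v set set \<Rightarrow> 'v set set \<Rightarrow> 'v \<Rightarrow> real" where
  "danger V q \<beta> \<delta> M B v = deg_star V q \<beta> \<delta> M v - real (deg B v)"

definition pot ::
  "'v set \<Rightarrow> nat \<Rightarrow> real \<Rightarrow> real \<Rightarrow> 'v set set \<Rightarrow> 'v set set \<Rightarrow> 'v \<Rightarrow> real" where
  "pot V q \<beta> \<delta> M B v =
     (if deg M v + deg B v = card V - 1 then 0
      else mu V q \<beta> \<delta> powr (danger V q \<beta> \<delta> M B v / real q))"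

definition pot_edge ::
  "'v set \<Rightarrow> nat \<Rightarrow> real \<Rightarrow> real \<Rightarrow> 'v set set \<Rightarrow> 'v set set \<Rightarrow> 'v set \<Rightarrow> real" where
  "pot_edge V q \<beta> \<delta> M B e = (\<Sum>x\<in>e. pot V q \<beta> \<delta> M B x)"

definition total_pot ::
  "'v set \<Rightarrow> nat \<Rightarrow> real \<Rightarrow> real \<Rightarrow> 'v set set \<Rightarrow> 'v set set \<Rightarrow> real" where
  "total_pot V q \<beta> \<delta> M B = (\<Sum>v\<in>V. pot V q \<beta> \<delta> M B v)"

text \<open>In turn \<open>t \<ge> 1\<close> Maker claims the edge \<open>m t\<close> and Breaker then claims the edges of the
  list \<open>b t\<close>, in this order. The following are the edge sets of the two players directly
  after turn \<open>t\<close>.\<close>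

definition maker_edges :: "(nat \<Rightarrow> 'v set) \<Rightarrow> nat \<Rightarrow> 'v set set" where
  "maker_edges m t = m ` {1..t}"

definition breaker_edges :: "(nat \<Rightarrow> 'v set list) \<Rightarrow> nat \<Rightarrow> 'v set set" where
  "breaker_edges b t = (\<Union>i\<in>{1..t}. set (b i))"

text \<open>Rules of the game for one turn from position \<open>(M, B)\<close>. In the last turn of the game
  fewer than \<open>q\<close> edges may be left for Breaker; he then claims all of them.\<close>

definition legal_turn ::
  "'v set \<Rightarrow> nat \<Rightarrow> 'v set set \<Rightarrow> 'v set set \<Rightarrow> 'v set \<Rightarrow> 'v set list \<Rightarrow> bool" where
  "legal_turn V q M B e bs \<longleftrightarrow>
     e \<in> unclaimed V M B \<and>
     distinct bs \<and> set bs \<subseteq> unclaimed V (insert e M) B \<and>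
     length bs = min q (card (unclaimed V (insert e M) B))"

text \<open>The pairs \<open>(x, w)\<close> such that Maker's new edge \<open>e = {x, y}\<close> creates a Maker path
  \<open>x, y, w\<close>. Such a path is to be closed by \<open>{x, w}\<close>, or else by a substitute edge at \<open>x\<close>.
  For \<open>e = {u, v}\<close> there are \<open>deg M v\<close> pairs with first component \<open>u\<close>, and \<open>deg M u\<close>
  with first component \<open>v\<close>.\<close>

definition closing_pairs :: "'v set set \<Rightarrow> 'v set \<Rightarrow> ('v \<times> 'v) set" where
  "closing_pairs M e = {(x, w). \<exists>y. e = {x, y} \<and> {y, w} \<in> M}"

definition part1_claim ::
  "'v set \<Rightarrow> 'v set set \<Rightarrow> 'v set set \<Rightarrow> 'v \<times> 'v \<Rightarrow> 'v set \<Rightarrow> bool" where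
  "part1_claim V M B p f \<longleftrightarrow>
     f \<in> unclaimed V M B \<and>
     (if {fst p, snd p} \<in> unclaimed V M B then f = {fst p, snd p}
      else if \<exists>g \<in> unclaimed V M B. fst p \<in> g then fst p \<in> f
      else True)"

definition part2_claim ::
  "'v set \<Rightarrow> nat \<Rightarrow> real \<Rightarrow> real \<Rightarrow> 'v set set \<Rightarrow> 'v set set \<Rightarrow> 'v set \<Rightarrow> bool" where
  "part2_claim V q \<beta> \<delta> M B f \<longleftrightarrow>
     is_arg_max (pot_edge V q \<beta> \<delta> M B) (\<lambda>g. g \<in> unclaimed V M B) f"

text \<open>The list \<open>cs\<close> is the order, chosen by Breaker, in which he treats the closing pairs.
  Every claim is made in the position that includes Maker's new edge and Breaker's earlier
  claims of the same turn.\<close>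

definition strategy_turn ::
  "'v set \<Rightarrow> nat \<Rightarrow> real \<Rightarrow> real \<Rightarrow> 'v set set \<Rightarrow> 'v set set \<Rightarrow> 'v set
     \<Rightarrow> ('v \<times> 'v) list \<Rightarrow> 'v set list \<Rightarrow> bool" where
  "strategy_turn V q \<beta> \<delta> M B e cs bs \<longleftrightarrow>
     distinct cs \<and> set cs = closing_pairs M e \<and>
     (\<forall>i < length bs.
        if i < length cs
        then part1_claim V (insert e M) (B \<union> set (take i bs)) (cs ! i) (bs ! i)
        else part2_claim V q \<beta> \<delta> (insert e M) (B \<union> set (take i bs)) (bs ! i))"

text \<open>The bound \<open>i < q\<close> restricts to the claims Breaker is entitled to in this turn.\<close>

definition isolation_turn ::
  "'v set \<Rightarrow> nat \<Rightarrow> 'v set set \<Rightarrow> 'v set set \<Rightarrow> 'v set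
     \<Rightarrow> ('v \<times> 'v) list \<Rightarrow> 'v set list \<Rightarrow> bool" where
  "isolation_turn V q M B e cs bs \<longleftrightarrow>
     (\<exists>i < length cs. i < q \<and>
        \<not> (\<exists>g \<in> unclaimed V (insert e M) (B \<union> set (take i bs)). fst (cs ! i) \<in> g))"

text \<open>The first \<open>T\<close> turns of a game; the game need not be finished after turn \<open>T\<close>.\<close>

definition strategy_play ::
  "'v set \<Rightarrow> nat \<Rightarrow> real \<Rightarrow> real \<Rightarrow> nat \<Rightarrow> (nat \<Rightarrow> 'v set)
     \<Rightarrow> (nat \<Rightarrow> ('v \<times> 'v) list) \<Rightarrow> (nat \<Rightarrow> 'v set list) \<Rightarrow> bool" where
  "strategy_play V q \<beta> \<delta> T m c b \<longleftrightarrow>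
     (\<forall>t\<in>{1..T}.
        legal_turn V q (maker_edges m (t - 1)) (breaker_edges b (t - 1)) (m t) (b t) \<and>
        strategy_turn V q \<beta> \<delta> (maker_edges m (t - 1)) (breaker_edges b (t - 1))
          (m t) (c t) (b t))"

end

theory Submission
  imports Defs
begin

text \<open>
  Let \<open>\<phi>\<close> be the maximum potential of an unclaimed edge and \<open>\<lambda> = ln \<mu>\<close>, which tends to 0 as \<open>n\<close>
  grows. The total potential itself may increase, but for a suitable constant \<open>K\<close> the augmented
  potential \<open>POT + K \<lambda> \<phi>\<close> never does. In a turn where Maker's edge joins vertices of Maker degree
  \<open>a\<close> and \<open>b\<close>, put \<open>s = 1 - (a + b) / q\<close>. Maker's edge and part 1 together raise \<open>POT\<close> by at most
  \<open>(\<mu> powr (p0 s) - 1) \<phi>\<close>, which is about \<open>\<lambda> p0 s \<phi>\<close>, and they raise \<open>\<phi>\<close> by a factor of at most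
  \<open>\<mu>\<close>. The \<open>s q\<close> greedy claims of part 2 lower \<open>POT\<close> by about \<open>\<lambda> s \<phi>'\<close>, where \<open>\<phi>'\<close> is the value of
  \<open>\<phi>\<close> after the turn. Since \<open>p0 < 1\<close>, either \<open>\<phi>'\<close> is close to \<open>\<phi>\<close> and \<open>POT\<close> drops by order
  \<open>\<lambda> \<phi>\<close>, or \<open>\<phi>\<close> drops by a constant factor and the term \<open>K \<lambda> \<phi>\<close> pays for the increase of \<open>POT\<close>.

  A lower bound on \<open>s\<close> comes from \<open>POT < 2 n\<close>: it bounds the danger of every vertex that still has
  an unclaimed edge, hence also its Maker degree, by \<open>(1 / 2 - \<delta> / 4) q\<close>.
\<close>

section \<open>Degrees and positions\<close>

lemma card_two_edge:
  assumes "card e = 2" "u \<in> e"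
  obtains w where "e = {u, w}" "w \<noteq> u"
  using assms by (auto simp: card_2_iff doubleton_eq_iff)

lemma finite_complete_edges: "finite V \<Longrightarrow> finite (complete_edges V)"
  unfolding complete_edges_def by (rule finite_subset[of _ "Pow V"]) auto

lemma deg_complete_edges:
  assumes "finite V" "v \<in> V"
  shows "deg (complete_edges V) v = card V - 1"
proof -
  have "{e \<in> complete_edges V. v \<in> e} = (\<lambda>w. {v, w}) ` (V - {v})"
  proof (intro set_eqI iffI)
    fix e assume "e \<in> {e \<in> complete_edges V. v \<in> e}"
    then have e: "e \<subseteq> V" "card e = 2" "v \<in> e" by (auto simp: complete_edges_def)
    then obtain w where "e = {v, w}" "w \<noteq> v" by (meson card_two_edge)
    with e show "e \<in> (\<lambda>w. {v, w}) ` (V - {v})" by auto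
  next
    fix e assume "e \<in> (\<lambda>w. {v, w}) ` (V - {v})"
    then show "e \<in> {e \<in> complete_edges V. v \<in> e}"
      using assms by (auto simp: complete_edges_def)
  qed
  moreover have "inj_on (\<lambda>w. {v, w}) (V - {v})"
    by (auto simp: inj_on_def doubleton_eq_iff)
  ultimately show ?thesis
    using assms by (simp add: deg_def card_image)
qed

lemma deg_Un_disjoint:
  assumes "finite A" "finite B" "A \<inter> B = {}"
  shows "deg (A \<union> B) v = deg A v + deg B v"
proof -
  have "{e \<in> A \<union> B. v \<in> e} = {e \<in> A. v \<in> e} \<union> {e \<in> B. v \<in> e}" by auto
  moreover have "{e \<in> A. v \<in> e} \<inter> {e \<in> B. v \<in> e} = {}" using assms(3) by auto
  ultimately show ?thesis
    unfolding deg_def using assms by (simp add: card_Un_disjoint)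
qed

lemma deg_mono: "finite B \<Longrightarrow> A \<subseteq> B \<Longrightarrow> deg A v \<le> deg B v"
  unfolding deg_def by (rule card_mono) auto

lemma deg_insert:
  assumes "finite A" "e \<notin> A"
  shows "deg (insert e A) v = deg A v + (if v \<in> e then 1 else 0)"
proof -
  have "deg {e} v = (if v \<in> e then 1 else 0)"
  proof (cases "v \<in> e")
    case True
    then have "{f \<in> {e}. v \<in> f} = {e}" by auto
    with True show ?thesis by (simp add: deg_def)
  qed (simp add: deg_def)
  then show ?thesis using deg_Un_disjoint[of A "{e}" v] assms by simp
qed

text \<open>Keeps only what degree counting needs. Turn order and the numbers of claimed edges are
  left out, so positions in the middle of a turn qualify too.\<close>

definition position :: "'v set \<Rightarrow> 'v set set \<Rightarrow> 'v set set \<Rightarrow> bool" where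
  "position V M B \<longleftrightarrow> M \<subseteq> complete_edges V \<and> B \<subseteq> complete_edges V \<and> M \<inter> B = {}"

lemma position_finite:
  assumes "finite V" "position V M B"
  shows "finite M" "finite B" "finite (unclaimed V M B)"
  using assms finite_complete_edges[of V]
  by (auto simp: position_def unclaimed_def intro: finite_subset)

lemma deg_position:
  assumes "finite V" "v \<in> V" "position V M B"
  shows "deg M v + deg B v + deg (unclaimed V M B) v = card V - 1"
proof -
  have "complete_edges V = (M \<union> B) \<union> unclaimed V M B"
    using assms(3) by (auto simp: position_def unclaimed_def)
  moreover have "deg ((M \<union> B) \<union> unclaimed V M B) v
      = deg M v + deg B v + deg (unclaimed V M B) v"
    using position_finite[OF assms(1,3)] assms(3)
    by (subst deg_Un_disjoint; (subst deg_Un_disjoint)?) (auto simp: position_def unclaimed_def)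
  ultimately show ?thesis using deg_complete_edges[OF assms(1,2)] by simp
qed

text \<open>Restates the zero case of \<open>pot\<close> in terms of unclaimed edges, a form whose
  persistence during the game is evident: claimed edges stay claimed.\<close>

lemma full_iff_no_unclaimed:
  assumes "finite V" "v \<in> V" "position V M B"
  shows "deg M v + deg B v = card V - 1 \<longleftrightarrow> (\<forall>g \<in> unclaimed V M B. v \<notin> g)"
proof -
  have "deg M v + deg B v = card V - 1 \<longleftrightarrow> deg (unclaimed V M B) v = 0"
    using deg_position[OF assms] by linarith
  also have "\<dots> \<longleftrightarrow> (\<forall>g \<in> unclaimed V M B. v \<notin> g)"
    using position_finite[OF assms(1,3)] by (auto simp: deg_def)
  finally show ?thesis .
qed

lemma position_insert_maker:
  "position V M B \<Longrightarrow> e \<in> unclaimed V M B \<Longrightarrow> position V (insert e M) B"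
  by (auto simp: position_def unclaimed_def)

lemma position_Un_breaker:
  "position V M B \<Longrightarrow> F \<subseteq> unclaimed V M B \<Longrightarrow> position V M (B \<union> F)"
  by (auto simp: position_def unclaimed_def)

lemma unclaimed_antimono:
  "M \<subseteq> M' \<Longrightarrow> B \<subseteq> B' \<Longrightarrow> unclaimed V M' B' \<subseteq> unclaimed V M B"
  by (auto simp: unclaimed_def)

lemma unclaimed_edgeD:
  assumes "e \<in> unclaimed V M B"
  shows "e \<subseteq> V" "card e = 2" "e \<notin> M" "e \<notin> B"
  using assms by (auto simp: unclaimed_def complete_edges_def)

section \<open>Closing pairs and the Breaker edges gained in part 1\<close>

text \<open>A pair \<open>(u, w)\<close> corresponds to the old Maker edge \<open>{v, w}\<close> at
  the other endpoint, whence the swap of \<open>u\<close> and \<open>v\<close>.\<close>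

lemma closing_pairs_slice:
  assumes "M \<subseteq> complete_edges V" "u \<noteq> v"
  shows "card {p \<in> closing_pairs M {u, v}. fst p = u} = deg M v"
proof -
  have "bij_betw (\<lambda>p. {v, snd p}) {p \<in> closing_pairs M {u, v}. fst p = u} {e \<in> M. v \<in> e}"
  proof (rule bij_betw_imageI)
    show "inj_on (\<lambda>p. {v, snd p}) {p \<in> closing_pairs M {u, v}. fst p = u}"
      by (auto simp: inj_on_def doubleton_eq_iff)
    show "(\<lambda>p. {v, snd p}) ` {p \<in> closing_pairs M {u, v}. fst p = u} = {e \<in> M. v \<in> e}"
    proof (intro set_eqI iffI)
      fix e assume "e \<in> (\<lambda>p. {v, snd p}) ` {p \<in> closing_pairs M {u, v}. fst p = u}"
      then show "e \<in> {e \<in> M. v \<in> e}"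
        using assms(2) by (auto simp: closing_pairs_def doubleton_eq_iff)
    next
      fix e assume "e \<in> {e \<in> M. v \<in> e}"
      then have "e \<in> M" "card e = 2" "v \<in> e"
        using assms by (auto simp: complete_edges_def)
      then obtain w where "e = {v, w}" "{v, w} \<in> M" by (metis card_two_edge)
      then show "e \<in> (\<lambda>p. {v, snd p}) ` {p \<in> closing_pairs M {u, v}. fst p = u}"
        by (intro image_eqI[of _ _ "(u, w)"]) (auto simp: closing_pairs_def)
    qed
  qed
  then show ?thesis unfolding deg_def by (rule bij_betw_same_card)
qed

lemma card_closing_pairs:
  assumes "M \<subseteq> complete_edges V" "u \<noteq> v"
    and "finite (closing_pairs M {u, v})"
  shows "card (closing_pairs M {u, v}) = deg M u + deg M v"
proof -
  let ?C = "closing_pairs M {u, v}"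
  have "?C = {p \<in> ?C. fst p = u} \<union> {p \<in> ?C. fst p = v}"
    by (auto simp: closing_pairs_def doubleton_eq_iff)
  then have "card ?C = card ({p \<in> ?C. fst p = u} \<union> {p \<in> ?C. fst p = v})" by simp
  also have "\<dots> = card {p \<in> ?C. fst p = u} + card {p \<in> ?C. fst p = v}"
    using assms(2,3) by (intro card_Un_disjoint) auto
  also have "card {p \<in> ?C. fst p = v} = deg M u"
    using closing_pairs_slice[of M V v u] assms(1,2) by (simp add: insert_commute)
  finally show ?thesis using closing_pairs_slice[of M V u v] assms(1,2) by simp
qed

text \<open>\<open>hit\<close> is what the absence of isolation provides. Distinct pairs with first
  component \<open>u\<close> are answered by distinct list entries containing \<open>u\<close>, so
  the map from index \<open>i\<close> to \<open>bs ! i\<close> injects the slice into the new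
  Breaker edges at \<open>u\<close>.\<close>

lemma deg_part1:
  assumes V: "finite V" and pos: "position V M B" and u: "u \<noteq> v"
    and cs: "distinct cs" "set cs = closing_pairs M {u, v}"
    and bs: "distinct bs" "set bs \<subseteq> unclaimed V M B" "length cs \<le> length bs"
    and hit: "\<And>i. i < length cs \<Longrightarrow> fst (cs ! i) \<in> bs ! i"
  shows "deg B u + deg M v \<le> deg (B \<union> set (take (length cs) bs)) u"
proof -
  let ?F = "set (take (length cs) bs)"
  let ?I = "{i. i < length cs \<and> fst (cs ! i) = u}"
  have F: "?F \<subseteq> unclaimed V M B" using bs(2) set_take_subset by fastforce
  have img: "(\<lambda>i. cs ! i) ` ?I = {p \<in> closing_pairs M {u, v}. fst p = u}"
    unfolding cs(2)[symmetric] set_conv_nth by blast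
  have "inj_on (\<lambda>i. cs ! i) ?I"
    using cs(1) by (auto simp: inj_on_def nth_eq_iff_index_eq)
  from card_image[OF this] have "card ?I = deg M v"
    unfolding img using closing_pairs_slice[of M V u v] pos u by (simp add: position_def)
  moreover have "card ?I \<le> deg ?F u"
    unfolding deg_def
  proof (rule card_inj_on_le[where f = "\<lambda>i. bs ! i"])
    show "inj_on (\<lambda>i. bs ! i) ?I"
      using bs(1,3) by (auto simp: inj_on_def nth_eq_iff_index_eq)
    show "(\<lambda>i. bs ! i) ` ?I \<subseteq> {e \<in> ?F. u \<in> e}"
      using hit bs(3) by (auto simp: in_set_conv_nth)
  qed simp
  moreover have "deg (B \<union> ?F) u = deg B u + deg ?F u"
    using position_finite[OF V pos] F by (intro deg_Un_disjoint) (auto simp: unclaimed_def)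
  ultimately show ?thesis by simp
qed

section \<open>The drift inequality\<close>

text \<open>Follows from \<open>exp y \<ge> 1 + y\<close>. With \<open>y = ln \<mu> / q\<close> it
  bounds from below the relative loss caused by one greedy claim.\<close>

lemma one_minus_exp_neg_ge:
  fixes y :: real
  assumes "0 \<le> y"
  shows "y - y\<^sup>2 \<le> 1 - exp (- y)"
proof -
  have "exp (- y) = 1 / exp y" by (simp add: exp_minus inverse_eq_divide)
  also have "\<dots> \<le> 1 / (1 + y)"
    using assms exp_ge_add_one_self[of y] by (intro divide_left_mono) auto
  also have "\<dots> \<le> 1 - y + y\<^sup>2"
  proof -
    have "(1 - y + y\<^sup>2) * (1 + y) = 1 + y ^ 3"
      by (simp add: algebra_simps power2_eq_square power3_eq_cube)
    then show ?thesis using assms by (simp add: divide_le_eq)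
  qed
  finally show ?thesis by simp
qed

text \<open>Here \<open>lam\<close> stands for \<open>ln \<mu>\<close> and \<open>p\<close> for
  \<open>p0\<close>; \<open>P\<close> and \<open>\<phi>\<close> are the total and the maximum edge
  potential before the turn, \<open>P'\<close> and \<open>\<phi>'\<close> after it; \<open>r\<close>
  collects the loss factors of all greedy claims.\<close>

lemma drift_nonpos:
  fixes lam p s \<sigma> \<phi> \<phi>' r K P P' :: real
  assumes p: "0 \<le> p" "p < 1" and K: "K = 4 / (1 - p)"
    and lam: "0 \<le> lam" "lam \<le> 1" "lam * (2 + 2 * K) \<le> \<sigma> * (1 - p) / 2"
    and s: "\<sigma> \<le> s" "0 \<le> s" "s \<le> 1"
    and r: "s * (lam - lam\<^sup>2) \<le> r"
    and \<phi>: "0 \<le> \<phi>" "0 \<le> \<phi>'" "\<phi>' \<le> exp lam * \<phi>"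
    and P: "P' \<le> P + (exp (lam * (p * s)) - 1) * \<phi> - r * \<phi>'"
  shows "P' + K * lam * \<phi>' \<le> P + K * lam * \<phi>"
proof -
  have K0: "0 \<le> K" using K p by simp
  have ll: "lam\<^sup>2 \<le> lam"
    using mult_right_mono[OF lam(2) lam(1)] by (simp add: power2_eq_square)
  have r0: "0 \<le> r"
    using r s(2) ll by (meson diff_ge_0_iff_ge mult_nonneg_nonneg order_trans)
  have ps: "0 \<le> p * s" "p * s \<le> 1" using p s by (auto intro: mult_le_one)
  have lps: "0 \<le> lam * (p * s)" "lam * (p * s) \<le> lam"
    using lam ps by (auto intro: mult_left_le)
  have "exp (lam * (p * s)) \<le> 1 + lam * (p * s) + (lam * (p * s))\<^sup>2"
    using lps lam by (intro exp_bound) auto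
  moreover have "(lam * (p * s))\<^sup>2 \<le> lam\<^sup>2" using lps by (intro power_mono) auto
  ultimately have grow: "exp (lam * (p * s)) - 1 \<le> lam * (p * s) + lam\<^sup>2" by simp
  show ?thesis
  \<comment> \<open>The threshold factor is \<open>(1 + p) / 2\<close>, midway between
    \<open>p\<close> and 1, so to first order in \<open>lam\<close> the greedy loss exceeds the
    growth by \<open>s * (1 - p) / 2\<close> times \<open>lam * \<phi>\<close>.\<close>
  proof (cases "\<phi>' \<ge> (1 - (1 - p) / 2) * \<phi>")
    case True
    have "exp lam \<le> 1 + lam + lam\<^sup>2" using lam by (intro exp_bound) auto
    then have "exp lam \<le> 1 + 2 * lam" using ll by simp
    from mult_right_mono[OF this \<phi>(1)] \<phi>(3) have "\<phi>' \<le> (1 + 2 * lam) * \<phi>" by linarith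
    from mult_left_mono[OF this, of "K * lam"] K0 lam(1)
    have A: "K * lam * \<phi>' \<le> K * lam * \<phi> + 2 * K * lam\<^sup>2 * \<phi>"
      by (simp add: algebra_simps power2_eq_square)
    have "s * (lam - lam\<^sup>2) * ((1 + p) / 2 * \<phi>) \<le> r * \<phi>'"
      using r True r0 p \<phi> by (intro mult_mono) (auto simp: field_simps)
    then have C: "s * (lam - lam\<^sup>2) * ((1 + p) / 2) * \<phi> \<le> r * \<phi>'" by (simp add: mult.assoc)
    have D: "(exp (lam * (p * s)) - 1) * \<phi> \<le> (lam * (p * s) + lam\<^sup>2) * \<phi>"
      using grow \<phi>(1) by (rule mult_right_mono)
    have "s * (1 + p) / 2 \<le> 1" using s p mult_mono[of s 1 "1 + p" 2] by simp
    from mult_left_mono[OF this, of "lam"] lam(1)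
    have E: "lam * (s * (1 + p) / 2) \<le> lam" by simp
    \<comment> \<open>The first-order surplus is at least \<open>\<sigma> * (1 - p) / 2\<close>. The
      second-order terms sum to at most \<open>lam * (2 + 2 * K)\<close>, which the third hypothesis
      on \<open>lam\<close> makes no larger.\<close>
    have "\<sigma> * (1 - p) \<le> s * (1 - p)" using s p by (intro mult_right_mono) auto
    moreover have "p * s - s * (1 + p) / 2 = - (s * (1 - p)) / 2" by (simp add: field_simps)
    moreover have "lam * (2 + 2 * K) = 2 * lam + 2 * K * lam" by (simp add: algebra_simps)
    ultimately have
      "p * s + lam - s * (1 + p) / 2 + lam * (s * (1 + p) / 2) + 2 * K * lam \<le> 0"
      using E lam(3) by linarith
    from mult_left_mono[OF this, of "lam * \<phi>"] lam(1) \<phi>(1)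
    have "(lam * (p * s) + lam\<^sup>2) * \<phi> + 2 * K * lam\<^sup>2 * \<phi>
        - s * (lam - lam\<^sup>2) * ((1 + p) / 2) * \<phi> \<le> 0"
      by (simp add: algebra_simps power2_eq_square)
    with A C D P show ?thesis by linarith
  next
    case False
    have "exp (lam * (p * s)) - 1 \<le> 2 * lam" using grow lps ll by simp
    from mult_right_mono[OF this \<phi>(1)] mult_nonneg_nonneg[OF r0 \<phi>(2)] P
    have 1: "P' \<le> P + 2 * lam * \<phi>" by linarith
    have "\<phi>' \<le> (1 - (1 - p) / 2) * \<phi>" using False by simp
    from mult_left_mono[OF this, of "K * lam"] K0 lam(1)
    have "K * lam * \<phi>' \<le> K * lam * \<phi> - (K * (1 - p)) * (lam * \<phi>) / 2"
      by (simp add: algebra_simps)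
    \<comment> \<open>The value of \<open>K\<close> makes the guaranteed drop exactly
      \<open>2 * lam * \<phi>\<close>, matching the bound on the growth of \<open>P\<close>.\<close>
    also have "K * (1 - p) = 4" using K p by (simp add: field_simps)
    finally show ?thesis using 1 by (simp add: mult_ac)
  qed
qed

section \<open>Change of the potential in one turn\<close>

text \<open>The element 0 is inserted because \<open>Max {}\<close> is unspecified: the value is 0 once all edges
  are claimed.\<close>

definition max_pot_edge ::
  "'v set \<Rightarrow> nat \<Rightarrow> real \<Rightarrow> real \<Rightarrow> 'v set set \<Rightarrow> 'v set set \<Rightarrow> real" where
  "max_pot_edge V q \<beta> \<delta> M B = Max (insert 0 (pot_edge V q \<beta> \<delta> M B ` unclaimed V M B))"

locale potential_game =
  fixes V :: "'v set" and q :: nat and \<beta> \<delta> :: real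
  assumes finite_V: "finite V" and q_pos: "q > 0"
    and mu_ge_1: "mu V q \<beta> \<delta> \<ge> 1"
    and p0_bounds: "0 \<le> p0 \<beta> \<delta>" "p0 \<beta> \<delta> \<le> 1"
begin

abbreviation "\<mu> \<equiv> mu V q \<beta> \<delta>"
abbreviation "dng \<equiv> danger V q \<beta> \<delta>"
abbreviation "vpot \<equiv> pot V q \<beta> \<delta>"
abbreviation "epot \<equiv> pot_edge V q \<beta> \<delta>"
abbreviation "tpot \<equiv> total_pot V q \<beta> \<delta>"
abbreviation "mpot \<equiv> max_pot_edge V q \<beta> \<delta>"
abbreviation "free \<equiv> unclaimed V"

section \<open>Comparing vertex potentials, and a single Breaker claim\<close>

lemma pot_nonneg: "0 \<le> vpot M B x"
  by (simp add: pot_def)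

lemma pot_edge_nonneg: "0 \<le> epot M B e"
  by (simp add: pot_edge_def sum_nonneg pot_nonneg)

lemma pot_eq:
  assumes "position V M B" "x \<in> V"
  shows "vpot M B x = (if \<forall>g \<in> free M B. x \<notin> g then 0 else \<mu> powr (dng M B x / q))"
  unfolding pot_def using full_iff_no_unclaimed[OF finite_V assms(2,1)] by simp

text \<open>A danger increment of \<open>q * y\<close> becomes a factor \<open>\<mu> powr y\<close>.
  The zero case does no harm: a vertex without unclaimed edges never regains one, so a zero
  potential stays zero.\<close>

lemma pot_le_powr_mult:
  assumes pos: "position V M B" "position V M' B'" and x: "x \<in> V"
    and sub: "free M' B' \<subseteq> free M B"
    and d: "dng M' B' x \<le> dng M B x + real q * y"
  shows "vpot M' B' x \<le> \<mu> powr y * vpot M B x"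
proof (cases "\<forall>g \<in> free M' B'. x \<notin> g")
  case True
  then show ?thesis by (simp add: pot_eq[OF pos(2) x] pot_nonneg)
next
  case False
  then have "\<not> (\<forall>g \<in> free M B. x \<notin> g)" using sub by blast
  moreover have "\<mu> powr (dng M' B' x / q) \<le> \<mu> powr (y + dng M B x / q)"
    using mu_ge_1 q_pos d by (intro powr_mono) (simp_all add: field_simps)
  ultimately show ?thesis
    using False by (auto simp: pot_eq[OF pos(1) x] pot_eq[OF pos(2) x] powr_add)
qed

lemma danger_breaker_antimono:
  assumes "position V M B'" "B \<subseteq> B'"
  shows "dng M B' x \<le> dng M B x"
  using deg_mono[of B' B x] position_finite[OF finite_V assms(1)] assms(2)
  by (simp add: danger_def)

lemma pot_breaker_antimono:
  assumes "position V M B" "position V M B'" "B \<subseteq> B'" "x \<in> V"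
  shows "vpot M B' x \<le> vpot M B x"
  using pot_le_powr_mult[OF assms(1,2,4), of 0] danger_breaker_antimono[OF assms(2,3), of x]
    unclaimed_antimono[of M M B B' V] assms(3) mu_ge_1 by simp

lemma pot_edge_breaker_antimono:
  assumes "position V M B" "position V M B'" "B \<subseteq> B'" "g \<subseteq> V"
  shows "epot M B' g \<le> epot M B g"
  unfolding pot_edge_def using assms by (intro sum_mono pot_breaker_antimono) auto

lemma total_pot_claim:
  assumes pos: "position V M B" and f: "f \<in> free M B"
  shows "tpot M (insert f B) \<le> tpot M B - (1 - \<mu> powr (- 1 / q)) * epot M B f"
proof -
  have pos': "position V M (insert f B)"
    using position_Un_breaker[OF pos, of "{f}"] f by simp
  have fV: "f \<subseteq> V" "f \<notin> B" using unclaimed_edgeD[OF f] by auto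
  have "vpot M (insert f B) x \<le> \<mu> powr (- 1 / q) * vpot M B x" if "x \<in> f" for x
  proof (rule pot_le_powr_mult[OF pos pos'])
    show "x \<in> V" using that fV by auto
    show "free M (insert f B) \<subseteq> free M B" by (intro unclaimed_antimono) auto
    show "dng M (insert f B) x \<le> dng M B x + real q * (- 1 / q)"
      using deg_insert[OF position_finite(2)[OF finite_V pos] fV(2), of x] that q_pos
      by (simp add: danger_def)
  qed
  then have "(\<Sum>x\<in>f. vpot M (insert f B) x) \<le> (\<Sum>x\<in>f. \<mu> powr (- 1 / q) * vpot M B x)"
    by (intro sum_mono) auto
  also have "\<dots> = \<mu> powr (- 1 / q) * epot M B f"
    by (simp add: pot_edge_def sum_distrib_left)
  finally have 1: "(\<Sum>x\<in>f. vpot M (insert f B) x) \<le> \<mu> powr (- 1 / q) * epot M B f" .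
  have 2: "(\<Sum>x\<in>V - f. vpot M (insert f B) x) \<le> (\<Sum>x\<in>V - f. vpot M B x)"
    by (intro sum_mono pot_breaker_antimono[OF pos pos']) auto
  have split: "tpot M B' = (\<Sum>x\<in>V - f. vpot M B' x) + (\<Sum>x\<in>f. vpot M B' x)" for B'
    unfolding total_pot_def by (rule sum.subset_diff[OF fV(1) finite_V])
  from 1 2 split[of B] split[of "insert f B"] show ?thesis
    by (simp add: pot_edge_def algebra_simps)
qed

section \<open>The effect of Maker's edge\<close>

text \<open>Raising the Maker degree from \<open>a\<close> to \<open>a + 1\<close> raises
  \<open>a * (q - a / 2)\<close> by \<open>q - a - 1 / 2\<close>. Crediting each of the
  \<open>k\<close> Breaker edges with only \<open>p0\<close> instead of 1 gives an exponent
  depending on \<open>a + k\<close> alone. With \<open>k\<close> the Maker degree of the other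
  endpoint, both endpoints get the same factor.\<close>

lemma pot_maker_endpoint:
  assumes pos: "position V M B" "position V (insert e M) B'" and e: "e \<in> free M B" "x \<in> e"
    and B: "B \<subseteq> B'" "deg B x + k \<le> deg B' x"
  shows "vpot (insert e M) B' x
    \<le> \<mu> powr (p0 \<beta> \<delta> * (1 - (real (deg M x) + real k) / q)) * vpot M B x"
proof (rule pot_le_powr_mult[OF pos])
  show "x \<in> V" using unclaimed_edgeD[OF e(1)] e by auto
  show "free (insert e M) B' \<subseteq> free M B" using B by (intro unclaimed_antimono) auto
  let ?a = "real (deg M x)" and ?p = "p0 \<beta> \<delta>"
  have "real (deg (insert e M) x) = ?a + 1"
    using deg_insert[of M e x] position_finite[OF finite_V pos(1)] unclaimed_edgeD[OF e(1)] e
    by simp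
  then have "deg_star V q \<beta> \<delta> (insert e M) x
      = deg_star V q \<beta> \<delta> M x + ?p * (q - ?a - 1 / 2)"
    by (simp add: deg_star_def power2_eq_square algebra_simps add_divide_distrib)
  moreover have "?p * (q - ?a - 1 / 2) \<le> ?p * (q - ?a)"
    using p0_bounds by (intro mult_left_mono) auto
  moreover have "?p * (q - ?a) - k \<le> ?p * (q - ?a) - ?p * k"
    using mult_right_mono[OF p0_bounds(2), of "real k"] by simp
  moreover have "real (deg B x) + k \<le> deg B' x" using B(2) by linarith
  ultimately have "dng (insert e M) B' x \<le> dng M B x + (?p * (q - ?a) - ?p * k)"
    unfolding danger_def by linarith
  also have "?p * (q - ?a) - ?p * k = q * (?p * (1 - (?a + k) / q))"
    using q_pos by (simp add: field_simps)
  finally show "dng (insert e M) B' x \<le> dng M B x + real q * (?p * (1 - (?a + k) / q))" .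
qed

lemma pot_maker_other:
  assumes pos: "position V M B" "position V (insert e M) B'" and e: "e \<in> free M B" "x \<in> V - e"
    and B: "B \<subseteq> B'"
  shows "vpot (insert e M) B' x \<le> vpot M B x"
proof -
  have "deg (insert e M) x = deg M x"
    using deg_insert[of M e x] position_finite[OF finite_V pos(1)] unclaimed_edgeD[OF e(1)] e
    by simp
  moreover have "deg B x \<le> deg B' x"
    using B position_finite[OF finite_V pos(2)] by (intro deg_mono)
  ultimately have "dng (insert e M) B' x \<le> dng M B x"
    by (simp add: danger_def deg_star_def)
  moreover have "free (insert e M) B' \<subseteq> free M B" using B by (intro unclaimed_antimono) auto
  ultimately show ?thesis
    using pot_le_powr_mult[OF pos, of x 0] e mu_ge_1 by simp
qed

text \<open>A crude bound for every vertex, crediting no closing edges: the exponent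
  \<open>p0 * (1 - a / q)\<close> never exceeds 1. It controls the growth of the maximum edge
  potential.\<close>

lemma pot_maker_le_mu:
  assumes pos: "position V M B" "position V (insert e M) B'" and e: "e \<in> free M B" "x \<in> V"
    and B: "B \<subseteq> B'"
  shows "vpot (insert e M) B' x \<le> \<mu> * vpot M B x"
proof (cases "x \<in> e")
  case True
  have "deg B x + 0 \<le> deg B' x"
    using B position_finite[OF finite_V pos(2)] by (simp add: deg_mono)
  from pot_maker_endpoint[OF pos e(1) True B this]
  have "vpot (insert e M) B' x \<le> \<mu> powr (p0 \<beta> \<delta> * (1 - deg M x / q)) * vpot M B x"
    by simp
  also have "p0 \<beta> \<delta> * (1 - deg M x / q) \<le> 1 * 1"
  proof (cases "1 - deg M x / real q \<ge> 0")
    case True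
    then show ?thesis using p0_bounds by (intro mult_mono) auto
  next
    case False
    then show ?thesis using p0_bounds by (intro order_trans[OF mult_nonneg_nonpos]) auto
  qed
  then have "\<mu> powr (p0 \<beta> \<delta> * (1 - deg M x / q)) \<le> \<mu> powr 1"
    using mu_ge_1 by (intro powr_mono) auto
  then have "\<mu> powr (p0 \<beta> \<delta> * (1 - deg M x / q)) * vpot M B x \<le> \<mu> * vpot M B x"
    using mu_ge_1 pot_nonneg by (intro mult_right_mono) auto
  finally show ?thesis .
next
  case False
  then have "vpot (insert e M) B' x \<le> 1 * vpot M B x"
    using pot_maker_other[OF pos e(1) _ B, of x] e by simp
  also have "\<dots> \<le> \<mu> * vpot M B x"
    using mu_ge_1 pot_nonneg by (intro mult_right_mono) auto
  finally show ?thesis .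
qed

section \<open>Maximum edge potential, and total potential through the two parts of a turn\<close>

lemma pot_edge_le_max:
  assumes "position V M B" "g \<in> free M B"
  shows "epot M B g \<le> mpot M B"
  unfolding max_pot_edge_def using assms position_finite[OF finite_V assms(1)] by auto

lemma max_pot_edge_le:
  assumes "position V M B" "0 \<le> z" "\<And>g. g \<in> free M B \<Longrightarrow> epot M B g \<le> z"
  shows "mpot M B \<le> z"
  unfolding max_pot_edge_def using assms position_finite[OF finite_V assms(1)] by auto

lemma max_pot_edge_nonneg: "position V M B \<Longrightarrow> 0 \<le> mpot M B"
  unfolding max_pot_edge_def using position_finite[OF finite_V] by auto

lemma max_pot_edge_maker:
  assumes pos: "position V M B" "position V (insert e M) B'" and e: "e \<in> free M B"
    and B: "B \<subseteq> B'"
  shows "mpot (insert e M) B' \<le> \<mu> * mpot M B"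
proof (rule max_pot_edge_le[OF pos(2)])
  show "0 \<le> \<mu> * mpot M B" using mu_ge_1 max_pot_edge_nonneg[OF pos(1)] by simp
  fix g assume g: "g \<in> free (insert e M) B'"
  then have g': "g \<in> free M B" using B by (auto simp: unclaimed_def)
  have "epot (insert e M) B' g \<le> (\<Sum>x\<in>g. \<mu> * vpot M B x)"
    unfolding pot_edge_def using unclaimed_edgeD(1)[OF g']
    by (intro sum_mono pot_maker_le_mu[OF pos e _ B]) auto
  also have "\<dots> = \<mu> * epot M B g" by (simp add: pot_edge_def sum_distrib_left)
  also have "\<dots> \<le> \<mu> * mpot M B"
    using mu_ge_1 pot_edge_le_max[OF pos(1) g'] by (intro mult_left_mono) auto
  finally show "epot (insert e M) B' g \<le> \<mu> * mpot M B" .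
qed

text \<open>Only the endpoints of \<open>e\<close> can gain, both by the same factor, and their
  joint potential before the turn is at most the maximum because \<open>e\<close> was then
  unclaimed.\<close>

lemma total_pot_after_part1:
  assumes pos: "position V M B" "position V (insert e M) B'" and e: "e \<in> free M B"
    and uv: "e = {u, v}" "u \<noteq> v" and B: "B \<subseteq> B'"
    and du: "deg B u + deg M v \<le> deg B' u" and dv: "deg B v + deg M u \<le> deg B' v"
    and s: "s = 1 - (real (deg M u) + real (deg M v)) / q" "0 \<le> s"
  shows "tpot (insert e M) B' \<le> tpot M B + (\<mu> powr (p0 \<beta> \<delta> * s) - 1) * mpot M B"
proof -
  let ?M = "insert e M" and ?c = "\<mu> powr (p0 \<beta> \<delta> * s)"
  have eV: "e \<subseteq> V" using unclaimed_edgeD[OF e] by auto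
  have "vpot ?M B' u \<le> ?c * vpot M B u"
    using pot_maker_endpoint[OF pos e _ B du] uv s by simp
  moreover have "vpot ?M B' v \<le> ?c * vpot M B v"
    using pot_maker_endpoint[OF pos e _ B dv] uv s by (simp add: add.commute)
  ultimately have 1: "epot ?M B' e \<le> ?c * epot M B e"
    using uv by (simp add: pot_edge_def distrib_left)
  have 2: "(\<Sum>x\<in>V - e. vpot ?M B' x) \<le> (\<Sum>x\<in>V - e. vpot M B x)"
    by (intro sum_mono pot_maker_other[OF pos e _ B]) auto
  have split: "tpot M B = (\<Sum>x\<in>V - e. vpot M B x) + epot M B e" for M B
    unfolding total_pot_def pot_edge_def by (rule sum.subset_diff[OF eV finite_V])
  have "1 \<le> ?c"
    using mu_ge_1 p0_bounds s by (intro ge_one_powr_ge_zero) auto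
  then have "(?c - 1) * epot M B e \<le> (?c - 1) * mpot M B"
    using pot_edge_le_max[OF pos(1) e] by (intro mult_left_mono) auto
  with 1 2 split[of M B] split[of ?M B'] show ?thesis
    by (simp add: algebra_simps)
qed

text \<open>An edge still unclaimed at the end of the turn was available at every greedy claim, with
  at least its final potential. Hence each greedy choice has at least the final maximum, and one
  common bound serves all claims.\<close>

lemma total_pot_part2:
  assumes pos: "position V M B" and bs: "distinct bs" "set bs \<subseteq> free M B"
    and k: "k \<le> i" "i \<le> length bs"
    and greedy: "\<And>j. k \<le> j \<Longrightarrow> j < length bs \<Longrightarrow>
      part2_claim V q \<beta> \<delta> M (B \<union> set (take j bs)) (bs ! j)"
  shows "tpot M (B \<union> set (take i bs)) \<le> tpot M (B \<union> set (take k bs))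
    - real (i - k) * ((1 - \<mu> powr (- 1 / q)) * mpot M (B \<union> set bs))"
  using k
proof (induction i rule: dec_induct)
  case base
  then show ?case by simp
next
  case (step j)
  let ?B = "B \<union> set (take j bs)" and ?B' = "B \<union> set bs" and ?f = "bs ! j"
  have j: "j < length bs" using step by simp
  have sub: "set (take j bs) \<subseteq> set bs" by (rule set_take_subset)
  have posj: "position V M ?B" using position_Un_breaker[OF pos] sub bs(2) by blast
  have pos': "position V M ?B'" using position_Un_breaker[OF pos bs(2)] .
  have "part2_claim V q \<beta> \<delta> M ?B ?f" using greedy step j by simp
  then have f: "?f \<in> free M ?B" "\<And>g. g \<in> free M ?B \<Longrightarrow> epot M ?B g \<le> epot M ?B ?f"
    unfolding part2_claim_def is_arg_max_linorder by auto
  have "mpot M ?B' \<le> epot M ?B ?f"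
  proof (rule max_pot_edge_le[OF pos' pot_edge_nonneg])
    fix g assume g: "g \<in> free M ?B'"
    then have "g \<in> free M ?B" using sub by (auto simp: unclaimed_def)
    from f(2)[OF this] pot_edge_breaker_antimono[OF posj pos' _ unclaimed_edgeD(1)[OF g]] sub
    show "epot M ?B' g \<le> epot M ?B ?f" by (meson Un_mono order_refl order_trans)
  qed
  moreover have "\<mu> powr (- 1 / q) \<le> \<mu> powr 0" using mu_ge_1 by (intro powr_mono) auto
  then have "0 \<le> 1 - \<mu> powr (- 1 / q)" using mu_ge_1 by simp
  ultimately have "(1 - \<mu> powr (- 1 / q)) * mpot M ?B' \<le> (1 - \<mu> powr (- 1 / q)) * epot M ?B ?f"
    by (intro mult_left_mono)
  moreover have "B \<union> set (take (Suc j) bs) = insert ?f ?B"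
    using j by (simp add: take_Suc_conv_app_nth)
  ultimately have "tpot M (B \<union> set (take (Suc j) bs))
      \<le> tpot M ?B - (1 - \<mu> powr (- 1 / q)) * mpot M ?B'"
    using total_pot_claim[OF posj f(1)] by simp
  with step show ?case by (simp add: Suc_diff_le algebra_simps)
qed

lemma no_unclaimed_total_pot:
  assumes "position V M B" "free M B = {}"
  shows "tpot M B = 0" "mpot M B = 0"
  using assms pot_eq[OF assms(1)] by (simp_all add: total_pot_def max_pot_edge_def)

lemma total_pot_nonneg: "0 \<le> tpot M B"
  by (simp add: total_pot_def sum_nonneg pot_nonneg)

lemma augmented_potential_turn:
  assumes pos: "position V M B"
    and legal: "legal_turn V q M B e bs"
    and strat: "strategy_turn V q \<beta> \<delta> M B e cs bs"
    and noiso: "\<not> isolation_turn V q M B e cs bs"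
    and uv: "e = {u, v}" "u \<noteq> v"
    and p: "p0 \<beta> \<delta> < 1" and K: "K = 4 / (1 - p0 \<beta> \<delta>)"
    and lam: "ln \<mu> \<le> 1" "ln \<mu> * (2 + 2 * K) \<le> \<sigma> * (1 - p0 \<beta> \<delta>) / 2"
    and s: "0 \<le> \<sigma>" "\<sigma> \<le> 1 - (real (deg M u) + real (deg M v)) / q"
  shows "tpot (insert e M) (B \<union> set bs) + K * ln \<mu> * mpot (insert e M) (B \<union> set bs)
    \<le> tpot M B + K * ln \<mu> * mpot M B"
proof -
  let ?M = "insert e M" and ?B = "B \<union> set bs" and ?k = "length cs"
  have e: "e \<in> free M B" and bs: "distinct bs" "set bs \<subseteq> free ?M B"
    and len: "length bs = min q (card (free ?M B))"
    using legal by (auto simp: legal_turn_def)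
  have pos': "position V ?M B" by (rule position_insert_maker[OF pos e])
  have posB: "position V ?M ?B" by (rule position_Un_breaker[OF pos' bs(2)])
  have lam0: "0 \<le> ln \<mu>" using mu_ge_1 by simp
  have K0: "0 \<le> K" using K p by simp
  show ?thesis
  proof (cases "length bs < q")
    \<comment> \<open>Fewer than \<open>q\<close> claims means that Breaker took everything left, so
      both potentials vanish.\<close>
    case True
    then have "card (set bs) = card (free ?M B)" using len bs(1) by (simp add: distinct_card)
    then have "set bs = free ?M B"
      using bs(2) position_finite[OF finite_V pos'] by (intro card_subset_eq) auto
    then have "free ?M ?B = {}" by (auto simp: unclaimed_def)
    from no_unclaimed_total_pot[OF posB this] show ?thesis
      using total_pot_nonneg max_pot_edge_nonneg[OF pos] lam0 K0 by simp
  next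
    case False
    then have lenq: "length bs = q" using len by simp
    have cs: "distinct cs" "set cs = closing_pairs M {u, v}"
      using strat uv by (auto simp: strategy_turn_def)
    have M: "M \<subseteq> complete_edges V" using pos by (simp add: position_def)
    have k: "?k = deg M u + deg M v"
      using card_closing_pairs[OF M uv(2)] cs by (metis List.finite_set distinct_card)
    define s' where "s' = 1 - (real (deg M u) + real (deg M v)) / q"
    have s'0: "0 \<le> s'" using s s'_def by simp
    \<comment> \<open>Thus \<open>q * s'\<close> is the number of part 2 claims, and
      \<open>s' \<ge> 0\<close> says that part 1 fits into the turn.\<close>
    have qs: "real q * s' = real q - ?k" using q_pos k by (simp add: s'_def field_simps)
    have kq: "?k \<le> q" using qs s'0 mult_nonneg_nonneg[of "real q" s'] by simp
    have hit: "fst (cs ! i) \<in> bs ! i" if "i < ?k" for i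
    proof -
      have "part1_claim V ?M (B \<union> set (take i bs)) (cs ! i) (bs ! i)"
        using strat that kq lenq by (auto simp: strategy_turn_def)
      moreover have "\<exists>g \<in> free ?M (B \<union> set (take i bs)). fst (cs ! i) \<in> g"
        using noiso that kq by (auto simp: isolation_turn_def)
      ultimately show ?thesis by (auto simp: part1_claim_def split: if_splits)
    qed
    have bs': "set bs \<subseteq> free M B" using bs(2) by (auto simp: unclaimed_def)
    let ?B1 = "B \<union> set (take ?k bs)"
    have pos1: "position V ?M ?B1"
      using position_Un_breaker[OF pos'] bs(2) set_take_subset[of ?k bs] by blast
    have du: "deg B u + deg M v \<le> deg ?B1 u"
      using deg_part1[OF finite_V pos uv(2) cs bs(1) bs'] kq lenq hit by simp
    have dv: "deg B v + deg M u \<le> deg ?B1 v"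
      using deg_part1[OF finite_V pos uv(2)[symmetric], of cs bs] cs bs(1) bs' kq lenq hit
      by (simp add: insert_commute)
    have part1: "tpot ?M ?B1 \<le> tpot M B + (\<mu> powr (p0 \<beta> \<delta> * s') - 1) * mpot M B"
      using total_pot_after_part1[OF pos pos1 e uv _ du dv s'_def s'0] by simp
    have "tpot ?M (B \<union> set (take q bs)) \<le> tpot ?M ?B1
        - real (q - ?k) * ((1 - \<mu> powr (- 1 / q)) * mpot ?M ?B)"
    proof (rule total_pot_part2[OF pos' bs kq])
      fix j assume "?k \<le> j" "j < length bs"
      then show "part2_claim V q \<beta> \<delta> ?M (B \<union> set (take j bs)) (bs ! j)"
        using strat by (simp add: strategy_turn_def)
    qed (simp add: lenq)
    then have part2: "tpot ?M ?B \<le> tpot ?M ?B1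
        - (q * s') * (1 - \<mu> powr (- 1 / q)) * mpot ?M ?B"
      using lenq kq by (simp add: qs of_nat_diff mult.assoc)
    have powr: "\<mu> powr y = exp (ln \<mu> * y)" for y
      using mu_ge_1 by (simp add: powr_def mult.commute)
    have rate: "s' * (ln \<mu> - (ln \<mu>)\<^sup>2) \<le> (q * s') * (1 - \<mu> powr (- 1 / q))"
    proof -
      have "real q * (ln \<mu> / q - (ln \<mu> / q)\<^sup>2) \<le> real q * (1 - exp (- (ln \<mu> / q)))"
        using lam0 q_pos by (intro mult_left_mono one_minus_exp_neg_ge) auto
      moreover have "real q * (ln \<mu> / q - (ln \<mu> / q)\<^sup>2) = ln \<mu> - (ln \<mu>)\<^sup>2 / q"
        using q_pos by (simp add: field_simps power2_eq_square)
      moreover have "(ln \<mu>)\<^sup>2 / q \<le> (ln \<mu>)\<^sup>2"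
        using q_pos divide_left_mono[of 1 "real q" "(ln \<mu>)\<^sup>2"] by simp
      ultimately have "ln \<mu> - (ln \<mu>)\<^sup>2 \<le> real q * (1 - \<mu> powr (- 1 / q))"
        by (simp add: powr)
      from mult_left_mono[OF this s'0] show ?thesis by (simp add: mult.assoc mult.left_commute)
    qed
    show ?thesis
    proof (rule drift_nonpos[OF p0_bounds(1) p K lam0 lam _ s'0 _ rate])
      show "\<sigma> \<le> s'" "s' \<le> 1" using s by (auto simp: s'_def)
      show "0 \<le> mpot M B" "0 \<le> mpot ?M ?B"
        using max_pot_edge_nonneg pos posB by auto
      show "mpot ?M ?B \<le> exp (ln \<mu>) * mpot M B"
        using max_pot_edge_maker[OF pos posB e] mu_ge_1 by simp
      show "tpot ?M ?B \<le> tpot M B + (exp (ln \<mu> * (p0 \<beta> \<delta> * s')) - 1) * mpot M B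
          - (q * s') * (1 - \<mu> powr (- 1 / q)) * mpot ?M ?B"
        using part1 part2 by (simp add: powr)
    qed
  qed
qed

section \<open>From small potential to small Maker degree\<close>

text \<open>A small potential means a small danger. Since the Breaker degree is at most
  \<open>card V\<close>, the leading term of \<open>deg_star\<close> cancels and a quadratic
  inequality for the Maker degree remains.\<close>

lemma maker_degree_bound:
  assumes pos: "position V M B" and g: "g \<in> free M B" "x \<in> g"
    and small: "vpot M B x < 2 * real (card V)"
    and rate: "\<mu> > 1" "ln (2 * real (card V)) \<le> ln \<mu> * (\<delta> * q / (4 * \<beta>))"
    and par: "0 < \<delta>" "\<delta> < 1" "0 < \<beta>"
    and half: "real (deg M x) \<le> real q / 2"
  shows "real (deg M x) \<le> (1 / 2 - \<delta> / 4) * q"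
proof -
  let ?a = "real (deg M x)" and ?n = "real (card V)"
  define C where "C = (1 - \<delta>) * (3 + \<delta>)"
  have x: "x \<in> V" using unclaimed_edgeD(1)[OF g(1)] g(2) by auto
  then have n: "card V > 0" using finite_V by (auto simp: card_gt_0_iff)
  have C: "C > 0" using par by (simp add: C_def)
  have pC: "p0 \<beta> \<delta> = 8 / (\<beta> * C)" by (simp add: p0_def C_def mult.assoc)
  have "\<mu> powr (dng M B x / q) < 2 * ?n"
    using small g pot_eq[OF pos x] by (auto split: if_splits)
  then have "ln (\<mu> powr (dng M B x / q)) < ln (2 * ?n)"
    using rate n by (subst ln_less_cancel_iff) auto
  then have "dng M B x / q * ln \<mu> < ln \<mu> * (\<delta> * q / (4 * \<beta>))"
    using rate by (simp add: ln_powr)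
  then have "ln \<mu> * (dng M B x / q) < ln \<mu> * (\<delta> * q / (4 * \<beta>))"
    by (simp only: mult.commute)
  moreover have "0 < ln \<mu>" using rate by simp
  ultimately have "dng M B x / q < \<delta> * q / (4 * \<beta>)"
    by (simp only: mult_less_cancel_left_pos)
  then have d: "dng M B x < \<delta> * q\<^sup>2 / (4 * \<beta>)"
    using q_pos by (simp add: field_simps power2_eq_square)
  have "real (deg B x) \<le> ?n"
    using deg_position[OF finite_V x pos] by simp
  moreover have "dng M B x = ?n - p0 \<beta> \<delta> * (q\<^sup>2 * C / 8)
      + p0 \<beta> \<delta> * (?a * (q - ?a / 2)) - real (deg B x)"
    by (simp add: danger_def deg_star_def C_def algebra_simps)
  ultimately have "p0 \<beta> \<delta> * (?a * (q - ?a / 2)) < p0 \<beta> \<delta> * (q\<^sup>2 * C / 8) + \<delta> * q\<^sup>2 / (4 * \<beta>)"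
    using d by linarith
  also have "\<dots> = p0 \<beta> \<delta> * (q\<^sup>2 * C / 8 * (1 + \<delta> / 4))"
    using C par by (simp add: pC field_simps)
  finally have "?a * (q - ?a / 2) < q\<^sup>2 * C / 8 * (1 + \<delta> / 4)"
    using C par by (simp add: pC mult_less_cancel_left_pos del: times_divide_eq_left times_divide_eq_right)
  moreover have "(q - ?a)\<^sup>2 = q\<^sup>2 - 2 * (?a * (q - ?a / 2))"
    by (simp add: power2_eq_square algebra_simps)
  ultimately have 1: "q\<^sup>2 * (1 - C / 4 * (1 + \<delta> / 4)) < (q - ?a)\<^sup>2"
    by (simp add: algebra_simps)
  have "1 - C / 4 * (1 + \<delta> / 4) - (1 / 2 + \<delta> / 4)\<^sup>2 = (\<delta> + 5 * \<delta>\<^sup>2 + \<delta> ^ 3) / 16"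
    by (simp add: C_def power2_eq_square power3_eq_cube field_simps)
  also have "\<dots> \<ge> 0" using par by simp
  finally have "(1 / 2 + \<delta> / 4)\<^sup>2 \<le> 1 - C / 4 * (1 + \<delta> / 4)" by simp
  from mult_left_mono[OF this, of "(real q)\<^sup>2"] 1
  have "((1 / 2 + \<delta> / 4) * q)\<^sup>2 < (q - ?a)\<^sup>2" by (simp add: power_mult_distrib mult.commute)
  \<comment> \<open>The squares alone would also allow \<open>?a\<close> above
    \<open>3 / 2 * q\<close>; \<open>half\<close> excludes this branch.\<close>
  then have "(1 / 2 + \<delta> / 4) * q < q - ?a"
    using half by (intro power_less_imp_less_base[of _ 2 "q - ?a"]) auto
  then show ?thesis by (simp add: algebra_simps)
qed

end

section \<open>The whole game\<close>

text \<open>The four conditions serve, in order, to get \<open>4 * ln 2 \<le> ln n\<close>, to start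
  the augmented potential below \<open>2 * n\<close>, to absorb one new Maker edge in the degree
  bound, and to make \<open>\<mu> - 1\<close> small. Writing \<open>ln n = 2 * ln (sqrt n)\<close>
  reduces the last one to the limit of \<open>ln x / x\<close>.\<close>

lemma bias_asymptotics:
  fixes \<beta> \<delta> \<epsilon> c :: real
  assumes "\<beta> > 0" "\<delta> > 0" "\<epsilon> > 0"
  shows "\<exists>N. \<forall>n::nat\<ge>N. n \<ge> 16 \<and> c < n \<and> 4 \<le> \<delta> * sqrt (\<beta> * n)
    \<and> 6 * \<beta> * ln n / (\<delta> * sqrt (\<beta> * n)) < \<epsilon>"
proof -
  have "(\<lambda>n::nat. ln (sqrt n) / sqrt n) \<longlonglongrightarrow> 0"
    by (rule filterlim_compose[OF ln_x_over_x_tendsto_0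
          filterlim_compose[OF sqrt_at_top filterlim_real_sequentially]])
  then have "(\<lambda>n::nat. 12 * \<beta> / (\<delta> * sqrt \<beta>) * (ln (sqrt n) / sqrt n)) \<longlonglongrightarrow> 0"
    by (rule tendsto_mult_right_zero)
  then have "eventually (\<lambda>n::nat. 12 * \<beta> / (\<delta> * sqrt \<beta>) * (ln (sqrt n) / sqrt n) < \<epsilon>) sequentially"
    using assms(3) by (rule order_tendstoD)
  moreover have "eventually (\<lambda>n::nat. max c ((4 / \<delta>)\<^sup>2 / \<beta>) < n) sequentially"
    using filterlim_real_sequentially by (rule filterlim_at_top_dense[THEN iffD1, rule_format])
  moreover have "eventually (\<lambda>n::nat. n \<ge> 16) sequentially" by (rule eventually_ge_at_top)
  ultimately have "eventually (\<lambda>n::nat. n \<ge> 16 \<and> c < n \<and> 4 \<le> \<delta> * sqrt (\<beta> * n)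
    \<and> 6 * \<beta> * ln n / (\<delta> * sqrt (\<beta> * n)) < \<epsilon>) sequentially"
  proof eventually_elim
    case (elim n)
    have "(4 / \<delta>)\<^sup>2 \<le> \<beta> * n" using elim(2) assms by (simp add: field_simps)
    then have "4 / \<delta> \<le> sqrt (\<beta> * n)" by (rule real_le_rsqrt)
    then have "4 \<le> \<delta> * sqrt (\<beta> * n)" using assms by (simp add: field_simps)
    moreover have "6 * \<beta> * ln n / (\<delta> * sqrt (\<beta> * n)) < \<epsilon>"
      using elim(1,3) by (simp add: ln_sqrt real_sqrt_mult mult.assoc)
    ultimately show ?case using elim by simp
  qed
  then show ?thesis by (simp add: eventually_sequentially)
qed

lemma maker_edges_Suc: "maker_edges m (Suc t) = insert (m (Suc t)) (maker_edges m t)"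
  by (simp add: maker_edges_def atLeastAtMostSuc_conv)

lemma breaker_edges_Suc: "breaker_edges b (Suc t) = breaker_edges b t \<union> set (b (Suc t))"
  by (auto simp: breaker_edges_def atLeastAtMostSuc_conv)

theorem theorem2p9:
  fixes \<epsilon> \<beta> \<delta> :: real
  assumes "\<epsilon> > 0" and "\<beta> = 8 / 3 + \<epsilon>"
    and "0 < \<delta>" and "\<delta> < 1 - 8 / (3 * \<beta>)"
  shows "\<exists>N. \<forall>n\<ge>N. \<forall>(V :: 'v set) (q :: nat) (T :: nat) m c b.
    finite V \<longrightarrow> card V = n \<longrightarrow> q = nat \<lceil>sqrt (\<beta> * real n)\<rceil> \<longrightarrow>
    strategy_play V q \<beta> \<delta> T m c b \<longrightarrow>
    (\<forall>t\<in>{1..T}. \<not> isolation_turn V q (maker_edges m (t - 1)) (breaker_edges b (t - 1))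
                    (m t) (c t) (b t)) \<longrightarrow>
    (\<forall>s\<le>T. total_pot V q \<beta> \<delta> (maker_edges m s) (breaker_edges b s) < 2 * real n)"
proof -
  define p where "p = p0 \<beta> \<delta>"
  define K where "K = 4 / (1 - p)"
  have \<beta>: "\<beta> > 0" using assms by simp
  have "8 / (3 * \<beta>) > 0" using \<beta> by simp
  then have \<delta>1: "\<delta> < 1" using assms by linarith
  \<comment> \<open>The upper bound on \<open>\<delta>\<close> is exactly what yields
    \<open>p0 < 1\<close>.\<close>
  have "8 < 3 * \<beta> * (1 - \<delta>)" using assms(4) \<beta> by (simp add: field_simps)
  also have "\<dots> < \<beta> * (1 - \<delta>) * (3 + \<delta>)"
    using mult_strict_left_mono[of 3 "3 + \<delta>" "\<beta> * (1 - \<delta>)"] \<beta> assms(3) \<delta>1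
    by (simp add: mult_ac)
  finally have p: "0 < p" "p < 1" by (auto simp: p_def p0_def)
  have K0: "0 < K" using p by (simp add: K_def)
  \<comment> \<open>The bound \<open>1 / 6\<close> gives
    \<open>ln (1 + \<eta>) \<ge> 5 / 6 * \<eta>\<close>; the other is the smallness condition of the
    drift inequality for \<open>\<sigma> = \<delta> / 2\<close>.\<close>
  define e0 where "e0 = min (1 / 6) (\<delta> / 2 * (1 - p) / 2 / (2 + 2 * K))"
  have e0: "0 < e0" using p K0 assms(3) by (simp add: e0_def)
  obtain N :: nat where N: "\<forall>n\<ge>N. n \<ge> 16 \<and> 2 * K < n \<and> 4 \<le> \<delta> * sqrt (\<beta> * n)
    \<and> 6 * \<beta> * ln n / (\<delta> * sqrt (\<beta> * n)) < e0"
    using bias_asymptotics[OF \<beta> assms(3) e0, of "2 * K"] ..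
  show ?thesis
  proof (intro exI[of _ N] allI impI)
    fix n q T s :: nat and V :: "'v set" and m c b
    assume n: "N \<le> n" and V: "finite V" "card V = n" and q: "q = nat \<lceil>sqrt (\<beta> * real n)\<rceil>"
      and play: "strategy_play V q \<beta> \<delta> T m c b"
      and noiso: "\<forall>t\<in>{1..T}. \<not> isolation_turn V q (maker_edges m (t - 1))
        (breaker_edges b (t - 1)) (m t) (c t) (b t)"
      and s: "s \<le> T"
    note N = N[rule_format, OF n]
    have n16: "real n \<ge> 16" using N by simp
    define \<eta> where "\<eta> = 6 * \<beta> * ln n / (\<delta> * q)"
    have mu: "mu V q \<beta> \<delta> = 1 + \<eta>" by (simp add: mu_def \<eta>_def V(2))
    have sq: "0 < sqrt (\<beta> * n)" using \<beta> n16 by simp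
    have qs: "sqrt (\<beta> * n) \<le> q" using q by linarith
    have q0: "q > 0" using qs sq by linarith
    have lnn: "0 < ln (real n)" using n16 by simp
    have \<eta>0: "0 < \<eta>" using \<beta> lnn assms(3) q0 by (simp add: \<eta>_def)
    have "\<eta> \<le> 6 * \<beta> * ln n / (\<delta> * sqrt (\<beta> * n))"
      unfolding \<eta>_def using \<beta> lnn assms(3) sq qs q0
      by (intro divide_left_mono mult_left_mono mult_pos_pos) auto
    then have \<eta>1: "\<eta> < e0" using N by linarith
    have lam_le: "ln (1 + \<eta>) \<le> \<eta>" using \<eta>0 by (intro ln_add_one_self_le_self) simp
    have lam0: "0 < ln (1 + \<eta>)" using \<eta>0 by simp
    have lam1: "ln (1 + \<eta>) \<le> 1" using lam_le \<eta>1 by (simp add: e0_def)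
    have "ln (1 + \<eta>) \<le> \<delta> / 2 * (1 - p) / 2 / (2 + 2 * K)"
      using lam_le \<eta>1 by (simp add: e0_def)
    then have lamK: "ln (1 + \<eta>) * (2 + 2 * K) \<le> \<delta> / 2 * (1 - p) / 2"
      using K0 by (subst (asm) pos_le_divide_eq) auto
    \<comment> \<open>The constant 6 in \<open>mu\<close> leaves room here: the right side is at
      least \<open>5 / 4 * ln n\<close>, which exceeds \<open>ln (2 * n)\<close> or equals it once
      \<open>n \<ge> 16\<close>.\<close>
    have rate: "ln (2 * real n) \<le> ln (1 + \<eta>) * (\<delta> * q / (4 * \<beta>))"
    proof -
      have "\<eta> * \<eta> \<le> \<eta> * (1 / 6)" using \<eta>0 \<eta>1 by (intro mult_left_mono) (auto simp: e0_def)
      moreover have "\<eta> - \<eta>\<^sup>2 \<le> ln (1 + \<eta>)"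
        using \<eta>0 \<eta>1 by (intro ln_one_plus_pos_lower_bound) (auto simp: e0_def)
      ultimately have "5 / 6 * \<eta> \<le> ln (1 + \<eta>)" by (simp add: power2_eq_square)
      then have "5 / 6 * \<eta> * (\<delta> * q / (4 * \<beta>)) \<le> ln (1 + \<eta>) * (\<delta> * q / (4 * \<beta>))"
        using assms(3) \<beta> by (intro mult_right_mono) auto
      moreover have "5 / 6 * \<eta> * (\<delta> * q / (4 * \<beta>)) = 5 / 4 * ln n"
        using \<beta> assms(3) q0 by (simp add: \<eta>_def field_simps)
      moreover have "4 * ln 2 = ln (2 ^ 4 :: real)" by (subst ln_realpow) auto
      then have "4 * ln 2 \<le> ln (real n)" using n16 by simp
      moreover have "ln (2 * real n) = ln 2 + ln n" using n16 by (simp add: ln_mult)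
      ultimately show ?thesis by linarith
    qed
    interpret potential_game V q \<beta> \<delta>
      using V q0 mu \<eta>0 p by unfold_locales (auto simp: p_def)
    let ?M = "maker_edges m" and ?B = "breaker_edges b"
    \<comment> \<open>The initial danger is \<open>n - q\<^sup>2 / \<beta>\<close>, nonpositive
      because \<open>q\<close> is \<open>sqrt (\<beta> * n)\<close> rounded up.\<close>
    have start: "vpot {} {} x \<le> 1" for x
    proof -
      have C: "(1 - \<delta>) * (3 + \<delta>) > 0" using assms(3) \<delta>1 by simp
      have "p0 \<beta> \<delta> * ((real q)\<^sup>2 * (1 - \<delta>) * (3 + \<delta>) / 8) = (real q)\<^sup>2 / \<beta>"
        using C \<beta> \<delta>1 assms(3) by (simp add: p0_def)
      then have "dng {} {} x = n - (real q)\<^sup>2 / \<beta>"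
        by (simp add: danger_def deg_star_def deg_def V(2))
      moreover have "(sqrt (\<beta> * n))\<^sup>2 \<le> (real q)\<^sup>2" using qs sq by (intro power_mono) auto
      then have "n \<le> (real q)\<^sup>2 / \<beta>" using \<beta> by (simp add: field_simps)
      ultimately have "dng {} {} x / q \<le> 0" by (simp add: divide_nonpos_nonneg)
      then have "\<mu> powr (dng {} {} x / q) \<le> \<mu> powr 0" using mu_ge_1 by (intro powr_mono) auto
      then show ?thesis using mu_ge_1 by (simp add: pot_def)
    qed
    \<comment> \<open>The weak degree bound \<open>q / 2\<close> is carried along to select the
      right branch of the quadratic inequality; the potential then sharpens it for the endpoints of
      the next Maker edge.\<close>
    have inv: "position V (?M t) (?B t) \<and> (\<forall>x. real (deg (?M t) x) \<le> real q / 2) \<and>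
        tpot (?M t) (?B t) + K * ln \<mu> * mpot (?M t) (?B t) < 2 * real n" if "t \<le> T" for t
      using that
    proof (induction t)
      case 0
      have [simp]: "?M 0 = {}" "?B 0 = {}" by (auto simp: maker_edges_def breaker_edges_def)
      have pos0: "position V {} {}" by (simp add: position_def)
      have "tpot {} {} \<le> (\<Sum>x\<in>V. 1)" unfolding total_pot_def by (intro sum_mono start)
      then have "tpot {} {} \<le> n" using V by simp
      moreover have "mpot {} {} \<le> 2"
      proof (rule max_pot_edge_le[OF pos0])
        fix g assume "g \<in> free {} {}"
        have "epot {} {} g \<le> (\<Sum>x\<in>g. 1)" unfolding pot_edge_def by (intro sum_mono start)
        then show "epot {} {} g \<le> 2" using unclaimed_edgeD(2)[OF \<open>g \<in> free {} {}\<close>] by simp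
      qed simp
      then have "K * ln \<mu> * mpot {} {} \<le> K * 1 * 2"
        using K0 lam0 lam1 mu max_pot_edge_nonneg[OF pos0] by (intro mult_mono) auto
      moreover have "2 * K < n" using N by simp
      ultimately show ?case using pos0 by (simp add: deg_def)
    next
      case (Suc t)
      let ?e = "m (Suc t)" and ?bs = "b (Suc t)" and ?cs = "c (Suc t)"
      have IH: "position V (?M t) (?B t)" "\<And>x. real (deg (?M t) x) \<le> real q / 2"
        "tpot (?M t) (?B t) + K * ln \<mu> * mpot (?M t) (?B t) < 2 * real n"
        using Suc by auto
      have t: "Suc t \<in> {1..T}" using Suc.prems by simp
      have legal: "legal_turn V q (?M t) (?B t) ?e ?bs"
        and strat: "strategy_turn V q \<beta> \<delta> (?M t) (?B t) ?e ?cs ?bs"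
        using play t unfolding strategy_play_def by fastforce+
      have ni: "\<not> isolation_turn V q (?M t) (?B t) ?e ?cs ?bs" using noiso t by fastforce
      have e: "?e \<in> free (?M t) (?B t)" and bs: "set ?bs \<subseteq> free (insert ?e (?M t)) (?B t)"
        using legal by (auto simp: legal_turn_def)
      obtain u v where uv: "?e = {u, v}" "u \<noteq> v"
        using unclaimed_edgeD(2)[OF e] by (auto simp: card_2_iff)
      have "0 \<le> K * ln \<mu> * mpot (?M t) (?B t)"
        using K0 lam0 mu max_pot_edge_nonneg[OF IH(1)] by simp
      then have tp: "tpot (?M t) (?B t) < 2 * real n" using IH(3) by linarith
      have dle: "real (deg (?M t) x) \<le> (1 / 2 - \<delta> / 4) * q" if "x \<in> ?e" for x
      proof (rule maker_degree_bound[OF IH(1) e that])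
        have "x \<in> V" using that unclaimed_edgeD(1)[OF e] by auto
        then have "vpot (?M t) (?B t) x \<le> tpot (?M t) (?B t)"
          unfolding total_pot_def using V pot_nonneg by (intro member_le_sum) auto
        then show "vpot (?M t) (?B t) x < 2 * real (card V)" using tp V by simp
      qed (use rate mu \<eta>0 V \<beta> assms(3) \<delta>1 IH(2) in auto)
      have "(real (deg (?M t) u) + real (deg (?M t) v)) \<le> (1 - \<delta> / 2) * q"
        using dle[of u] dle[of v] uv by (simp add: algebra_simps)
      then have "\<delta> / 2 \<le> 1 - (real (deg (?M t) u) + real (deg (?M t) v)) / q"
        using q0 by (simp add: field_simps)
      then have "tpot (?M (Suc t)) (?B (Suc t)) + K * ln \<mu> * mpot (?M (Suc t)) (?B (Suc t))
          \<le> tpot (?M t) (?B t) + K * ln \<mu> * mpot (?M t) (?B t)"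
        unfolding maker_edges_Suc breaker_edges_Suc
        using p lam1 lamK mu assms(3)
        by (intro augmented_potential_turn[OF IH(1) legal strat ni uv, where \<sigma> = "\<delta> / 2"])
          (auto simp: p_def K_def)
      moreover have "position V (?M (Suc t)) (?B (Suc t))"
        unfolding maker_edges_Suc breaker_edges_Suc
        by (rule position_Un_breaker[OF position_insert_maker[OF IH(1) e] bs])
      moreover have "real (deg (?M (Suc t)) x) \<le> real q / 2" for x
      proof -
        \<comment> \<open>An endpoint had degree at most \<open>(1 / 2 - \<delta> / 4) * q\<close>;
          the new edge adds 1, which is at most \<open>\<delta> * q / 4\<close>, so
          \<open>q / 2\<close> holds again.\<close>
        have "4 \<le> \<delta> * q" using N mult_left_mono[OF qs, of \<delta>] assms(3) by linarith
        then show ?thesis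
          using deg_insert[of "?M t" ?e x] position_finite[OF V(1) IH(1)] unclaimed_edgeD[OF e]
            IH(2)[of x] dle[of x]
          by (auto simp: maker_edges_Suc algebra_simps)
      qed
      ultimately show ?case using IH(3) by auto
    qed
    have "0 \<le> K * ln \<mu> * mpot (?M s) (?B s)"
      using K0 lam0 mu max_pot_edge_nonneg inv[OF s] by simp
    then show "tpot (?M s) (?B s) < 2 * real n" using inv[OF s] by linarith
  qed
qed

end
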